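(* There is a content-oblivious algorithm of message complexity $n^{O(1)}$ that, with high probability, elects a leader and orients an anonymous ring of $n$ nodes, each with access to its own source of randomness. The algorithm reaches quiescence but does not terminate.
   Context: Content-oblivious model: ring of $n$ nodes, each with two ports (Port 0, Port 1) connected to its two neighbours in an arbitrary (non-oriented) way; messages are content-free pulses; asynchronous delivery with arbitrary finite delays, no loss or injection; nodes are event-driven. Anonymous: nodes are identical (no IDs) and do not know $n$, but each has an independent source of randomness. With high probability: the algorithm is parameterized by a constant $c>0$ and for every $n$ succeeds with probability at least $1-O(n^{-c})$. Success means: eventually no pulses are in transit (quiescence), and at that time exactly one node has internal state Leader and all others Non-Leader, and each node has labelled exactly one of its ports as clockwise such that starting from any node and repeatedly moving to the neighbour at the clockwise port passes through all edges of the ring. Message complexity: total number of pulses sent. *)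

theory Defs
  imports "HOL-Probability.Probability"
begin

datatype port = Port0 | Port1

fun other_port :: "port \<Rightarrow> port" where
  "other_port Port0 = Port1"
| "other_port Port1 = Port0"

datatype role = Undecided | Leader | NonLeader

text \<open>
  The random source of a node is an infinite tape of independent fair coin flips.
\<close>

type_synonym tape = "nat \<Rightarrow> bool"

definition tape_space :: "tape measure" where
  "tape_space = Pi\<^sub>M UNIV (\<lambda>_. measure_pmf (bernoulli_pmf (1/2)))"

definition random_space :: "nat \<Rightarrow> (nat \<Rightarrow> tape) measure" where
  "random_space n = Pi\<^sub>M {..<n} (\<lambda>_. tape_space)"

text \<open>
  The program of a node. An action returns the new memory contents (finite information,
  encoded as a natural number) and the number of pulses emitted on each port.
  Pulses carry no content, so a reception is described by its port alone. Neither the number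
  of nodes nor the name of the node is an argument, so nodes are anonymous and uniform.
\<close>

record algorithm =
  on_start :: "tape \<Rightarrow> nat \<times> (port \<Rightarrow> nat)"
  on_pulse :: "tape \<Rightarrow> nat \<Rightarrow> port \<Rightarrow> nat \<times> (port \<Rightarrow> nat)"
  role_of :: "nat \<Rightarrow> role"
  clockwise_ports :: "nat \<Rightarrow> port set"
  terminated :: "nat \<Rightarrow> bool"

definition randomized_algorithm :: "algorithm \<Rightarrow> bool" where
  "randomized_algorithm A \<longleftrightarrow>
     on_start A \<in> tape_space \<rightarrow>\<^sub>M count_space UNIV \<and>
     (\<forall>s p. (\<lambda>\<tau>. on_pulse A \<tau> s p) \<in> tape_space \<rightarrow>\<^sub>M count_space UNIV)"

text \<open>
  The nodes are \<open>0, \<dots>, n - 1\<close> in the order in which they lie on the ring, and edge \<open>i\<close> joins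
  \<open>i\<close> and \<open>(i + 1) mod n\<close>. The arbitrary wiring of the ports is given by \<open>w\<close>: port \<open>w i\<close> of
  node \<open>i\<close> is attached to edge \<open>i\<close>, the other one to edge \<open>(i - 1) mod n\<close>. For \<open>n = 1\<close> the
  ring is a loop, for \<open>n = 2\<close> it has two parallel edges.
\<close>

definition edge_at :: "nat \<Rightarrow> (nat \<Rightarrow> port) \<Rightarrow> nat \<times> port \<Rightarrow> nat" where
  "edge_at n w = (\<lambda>(i, p). if p = w i then i else (i + n - 1) mod n)"

definition opposite_end :: "nat \<Rightarrow> (nat \<Rightarrow> port) \<Rightarrow> nat \<times> port \<Rightarrow> nat \<times> port" where
  "opposite_end n w = (\<lambda>(i, p).
     if p = w i then (let j = (i + 1) mod n in (j, other_port (w j)))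
     else (let j = (i + n - 1) mod n in (j, w j)))"

text \<open>
  \<open>transit C (i, p)\<close> is the number of pulses on their way to port \<open>p\<close> of node \<open>i\<close>, and
  \<open>sent C\<close> is the number of all pulses sent so far.
\<close>

record configuration =
  memory :: "nat \<Rightarrow> nat"
  transit :: "nat \<times> port \<Rightarrow> nat"
  sent :: nat

definition quiescent :: "configuration \<Rightarrow> bool" where
  "quiescent C \<longleftrightarrow> (\<forall>e. transit C e = 0)"

definition emission :: "nat \<Rightarrow> (nat \<Rightarrow> port) \<Rightarrow> nat \<Rightarrow> (port \<Rightarrow> nat) \<Rightarrow> nat \<times> port \<Rightarrow> nat" where
  "emission n w i out e = (\<Sum>q\<in>{Port0, Port1}. if opposite_end n w (i, q) = e then out q else 0)"

text \<open>
  All nodes act once at the beginning. A late start of a node is indistinguishable from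
  a longer delay of the pulses to and from it.
\<close>

definition initial_configuration ::
  "algorithm \<Rightarrow> nat \<Rightarrow> (nat \<Rightarrow> port) \<Rightarrow> (nat \<Rightarrow> tape) \<Rightarrow> configuration" where
  "initial_configuration A n w \<omega> =
     \<lparr> memory = (\<lambda>i. fst (on_start A (\<omega> i))),
       transit = (\<lambda>e. \<Sum>i<n. emission n w i (snd (on_start A (\<omega> i))) e),
       sent = (\<Sum>i<n. \<Sum>q\<in>{Port0, Port1}. snd (on_start A (\<omega> i)) q) \<rparr>"

text \<open>A terminated node discards every further pulse without reacting.\<close>

definition deliver ::
  "algorithm \<Rightarrow> nat \<Rightarrow> (nat \<Rightarrow> port) \<Rightarrow> (nat \<Rightarrow> tape) \<Rightarrow> nat \<times> port \<Rightarrow> configuration \<Rightarrow> configuration"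
where
  "deliver A n w \<omega> = (\<lambda>(i, p) C.
     let (s, out) = (if terminated A (memory C i) then (memory C i, \<lambda>_. 0)
                     else on_pulse A (\<omega> i) (memory C i) p)
     in \<lparr> memory = (memory C)(i := s),
          transit = (\<lambda>e. (if e = (i, p) then transit C e - 1 else transit C e)
                         + emission n w i out e),
          sent = sent C + (\<Sum>q\<in>{Port0, Port1}. out q) \<rparr>)"

text \<open>
  \<open>\<sigma> t\<close> is the port at which the \<open>t\<close>-th delivery takes place; once no pulse is in transit,
  nothing happens any more and the remaining entries of \<open>\<sigma>\<close> are irrelevant.
  Delays are arbitrary but finite: the last conjunct excludes that a pulse stays in transit
  forever. (As pulses are indistinguishable, those heading for the same port may be assumed to
  arrive in order.)
\<close>

definition execution ::
  "algorithm \<Rightarrow> nat \<Rightarrow> (nat \<Rightarrow> port) \<Rightarrow> (nat \<Rightarrow> tape) \<Rightarrow>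
   (nat \<Rightarrow> nat \<times> port) \<Rightarrow> (nat \<Rightarrow> configuration) \<Rightarrow> bool"
where
  "execution A n w \<omega> \<sigma> C \<longleftrightarrow>
     C 0 = initial_configuration A n w \<omega> \<and>
     (\<forall>t. if quiescent (C t) then C (Suc t) = C t
          else transit (C t) (\<sigma> t) > 0 \<and> C (Suc t) = deliver A n w \<omega> (\<sigma> t) (C t)) \<and>
     (\<forall>t e. transit (C t) e > 0 \<longrightarrow> (\<exists>t'\<ge>t. \<sigma> t' = e))"

definition leader_elected :: "algorithm \<Rightarrow> nat \<Rightarrow> configuration \<Rightarrow> bool" where
  "leader_elected A n C \<longleftrightarrow>
     (\<exists>l<n. role_of A (memory C l) = Leader \<and>
            (\<forall>i<n. i \<noteq> l \<longrightarrow> role_of A (memory C i) = NonLeader))"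

definition clockwise_end :: "algorithm \<Rightarrow> configuration \<Rightarrow> nat \<Rightarrow> nat \<times> port" where
  "clockwise_end A C i = (i, the_elem (clockwise_ports A (memory C i)))"

definition clockwise_neighbour ::
  "algorithm \<Rightarrow> nat \<Rightarrow> (nat \<Rightarrow> port) \<Rightarrow> configuration \<Rightarrow> nat \<Rightarrow> nat" where
  "clockwise_neighbour A n w C i = fst (opposite_end n w (clockwise_end A C i))"

definition oriented :: "algorithm \<Rightarrow> nat \<Rightarrow> (nat \<Rightarrow> port) \<Rightarrow> configuration \<Rightarrow> bool" where
  "oriented A n w C \<longleftrightarrow>
     (\<forall>i<n. \<exists>p. clockwise_ports A (memory C i) = {p}) \<and>
     (\<forall>i<n. {edge_at n w (clockwise_end A C ((clockwise_neighbour A n w C ^^ k) i)) | k. True}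
            = {..<n})"

definition succeeds ::
  "algorithm \<Rightarrow> nat \<Rightarrow> (nat \<Rightarrow> port) \<Rightarrow> (nat \<Rightarrow> configuration) \<Rightarrow> bool" where
  "succeeds A n w C \<longleftrightarrow>
     (\<exists>T. quiescent (C T) \<and> leader_elected A n (C T) \<and> oriented A n w (C T))"

definition reaches_quiescence :: "(nat \<Rightarrow> configuration) \<Rightarrow> bool" where
  "reaches_quiescence C \<longleftrightarrow> (\<exists>T. quiescent (C T))"

definition never_terminates :: "algorithm \<Rightarrow> nat \<Rightarrow> (nat \<Rightarrow> configuration) \<Rightarrow> bool" where
  "never_terminates A n C \<longleftrightarrow> (\<forall>t. \<forall>i<n. \<not> terminated A (memory (C t) i))"

definition message_complexity_le :: "(nat \<Rightarrow> configuration) \<Rightarrow> real \<Rightarrow> bool" where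
  "message_complexity_le C b \<longleftrightarrow> (\<forall>t. real (sent (C t)) \<le> b)"

text \<open>
  The universal quantifier over executions lies inside the event: delays may be chosen by
  an adversary who sees all coin flips. As \<open>measure\<close> is \<open>0\<close> on non-measurable sets, the lower
  bound includes measurability of the event whenever it is positive.
\<close>

definition elects_whp :: "algorithm \<Rightarrow> real \<Rightarrow> bool" where
  "elects_whp A c \<longleftrightarrow>
     (\<exists>K M :: real. \<exists>d :: nat. \<forall>n\<ge>1. \<forall>w.
        measure (random_space n)
          {\<omega> \<in> space (random_space n). \<forall>\<sigma> C. execution A n w \<omega> \<sigma> C \<longrightarrow>
             succeeds A n w C \<and> message_complexity_le C (M * real n ^ d)}
        \<ge> 1 - K * real n powr (- c))"

end

theory Submission
  imports Defs "HOL-Real_Asymp.Real_Asymp"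
begin

text \<open>
  Every pulse travels around the ring in one fixed direction, and each node gives one limit to each
  direction: \<open>2 x + 1\<close> for the pulses arriving at port 0 and \<open>2 x + 2\<close> for those arriving at port 1,
  where \<open>x\<close> is its identifier. It starts by emitting a pulse in each direction, relays every
  pulse, but absorbs the one with which a counter reaches its limit. In each direction all counters
  rise until they equal the largest limit of that direction. If the largest identifier is unique,
  its owner holds the largest limit of all; so the two directions end with different counts, all
  nodes agree on the direction with the larger one, and only the owner finds the counter at port 1
  equal to its own limit.

  An identifier consists of \<open>L g\<close> fair random bits with \<open>g\<close> geometric, which gives it a
  heavy-tailed distribution: with high probability some node has \<open>2\<^sup>g\<close> at least about \<open>\<surd>n\<close>, hence so
  many random bits that no other node shares its identifier, while no identifier is larger than a
  fixed power of \<open>n\<close>.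
\<close>

section \<open>The relay algorithm\<close>

text \<open>For x < y even \<open>2 * x + 2 < 2 * y + 1\<close>, so the larger identifier has the
  larger limit however the two nodes are wired.\<close>

definition limit :: "nat \<Rightarrow> port \<Rightarrow> nat" where
  "limit x p = (case p of Port0 \<Rightarrow> 2 * x + 1 | Port1 \<Rightarrow> 2 * x + 2)"

text \<open>The identifier is kept in memory so that reactions to pulses never consult the
  tape.\<close>

definition encode :: "nat \<Rightarrow> (port \<Rightarrow> nat) \<Rightarrow> nat" where
  "encode x r = prod_encode (x, prod_encode (r Port0, r Port1))"

definition ident_of :: "nat \<Rightarrow> nat" where
  "ident_of s = fst (prod_decode s)"

definition count_of :: "nat \<Rightarrow> port \<Rightarrow> nat" where
  "count_of s p = (case p of Port0 \<Rightarrow> fst (prod_decode (snd (prod_decode s)))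
                           | Port1 \<Rightarrow> snd (prod_decode (snd (prod_decode s))))"

lemma ident_of_encode [simp]: "ident_of (encode x r) = x"
  by (simp add: ident_of_def encode_def)

lemma count_of_encode [simp]: "count_of (encode x r) = r"
  by (auto simp: count_of_def encode_def fun_eq_iff split: port.split)

text \<open>A relayed pulse leaves by the opposite port and so keeps its direction. Role and
  orientation are provisional until quiescence; once the counts differ, the clockwise port is the
  one by which pulses of the larger count leave.\<close>

definition relay_alg :: "(tape \<Rightarrow> nat) \<Rightarrow> algorithm" where
  "relay_alg I =
     \<lparr> on_start = (\<lambda>\<tau>. (encode (I \<tau>) (\<lambda>_. 0), \<lambda>_. 1)),
       on_pulse = (\<lambda>_ s p. let k = Suc (count_of s p) in
         (encode (ident_of s) ((count_of s)(p := k)),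
          \<lambda>q. if q = other_port p then (if k = limit (ident_of s) p then 0 else 1) else 0)),
       role_of = (\<lambda>s. if count_of s Port1 = limit (ident_of s) Port1 then Leader else NonLeader),
       clockwise_ports = (\<lambda>s. {if count_of s Port0 < count_of s Port1 then Port0 else Port1}),
       terminated = (\<lambda>_. False) \<rparr>"

lemma relay_alg_simps [simp]:
  "on_start (relay_alg I) = (\<lambda>\<tau>. (encode (I \<tau>) (\<lambda>_. 0), \<lambda>_. 1))"
  "on_pulse (relay_alg I) = (\<lambda>_ s p. let k = Suc (count_of s p) in
         (encode (ident_of s) ((count_of s)(p := k)),
          \<lambda>q. if q = other_port p then (if k = limit (ident_of s) p then 0 else 1) else 0))"
  "role_of (relay_alg I) = (\<lambda>s. if count_of s Port1 = limit (ident_of s) Port1 then Leader else NonLeader)"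
  "clockwise_ports (relay_alg I) = (\<lambda>s. {if count_of s Port0 < count_of s Port1 then Port0 else Port1})"
  "terminated (relay_alg I) = (\<lambda>_. False)"
  by (simp_all add: relay_alg_def)

section \<open>Ports and cyclic arithmetic of the ring\<close>

lemma other_port_neq [simp]: "other_port p \<noteq> p" "p \<noteq> other_port p"
  by (cases p; simp)+

lemma other_port_other_port [simp]: "other_port (other_port p) = p"
  by (cases p) simp_all

lemma other_port_eq_iff: "other_port p = q \<longleftrightarrow> p \<noteq> q"
  by (cases p; cases q) simp_all

lemma UNIV_port: "(UNIV :: port set) = {Port0, Port1}"
  using port.exhaust by auto

lemma finite_UNIV_port [simp]: "finite (UNIV :: port set)"
  by (simp add: UNIV_port)

lemma mod_pred_Suc: "i < n \<Longrightarrow> ((i + n - 1) mod n + 1) mod n = (i :: nat)"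
  by (cases i) (simp_all add: mod_Suc)

lemma mod_Suc_pred: "i < n \<Longrightarrow> ((i + 1) mod n + n - 1) mod n = (i :: nat)"
  by (cases "Suc i = n") simp_all

lemma opposite_end_involution:
  assumes "fst e < n"
  shows "opposite_end n w (opposite_end n w e) = e"
  using assms mod_pred_Suc[of "fst e" n] mod_Suc_pred[of "fst e" n]
  by (cases e) (auto simp: opposite_end_def Let_def other_port_eq_iff)

lemma fst_opposite_end_less: "0 < n \<Longrightarrow> fst (opposite_end n w e) < n"
  by (cases e) (auto simp: opposite_end_def Let_def)

lemma emission_single:
  "emission n w i (\<lambda>q. if q = p then k else 0) e = (if opposite_end n w (i, p) = e then k else 0)"
  by (cases p) (auto simp: emission_def)

text \<open>Going around once gives \<open>f 0 \<le> f i \<le> f (n - 1) \<le> f 0\<close>.\<close>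

lemma cyclic_mono_const:
  fixes f :: "nat \<Rightarrow> nat"
  assumes "\<And>i. i < n \<Longrightarrow> f i \<le> f ((i + 1) mod n)" "i < n" "j < n"
  shows "f i = f j"
proof -
  have up: "f a \<le> f b" if "a \<le> b" "b < n" for a b
    using that
  proof (induction b rule: dec_induct)
    case (step m)
    then show ?case using assms(1)[of m] by simp
  qed simp
  have "f (n - 1) \<le> f 0"
    using assms(1)[of "n - 1"] assms(2) by simp
  moreover have "f 0 \<le> f i" "f i \<le> f (n - 1)" "f 0 \<le> f j" "f j \<le> f (n - 1)"
    using up assms(2,3) by auto
  ultimately show ?thesis by simp
qed

lemma orbit_Suc:
  fixes i n :: nat
  assumes "i < n"
  shows "{((\<lambda>j. (j + 1) mod n) ^^ k) i | k. True} = {..<n}"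
proof -
  have iter: "((\<lambda>j. (j + 1) mod n) ^^ k) i = (i + k) mod n" for k
    using assms by (induction k) (simp_all add: mod_Suc_eq)
  have "j = (i + (j + n - i)) mod n" if "j < n" for j
    using that assms by simp
  then have "{..<n} \<subseteq> range (\<lambda>k. (i + k) mod n)" by blast
  then show ?thesis using assms unfolding iter by auto
qed

text \<open>The extra predecessor step turns a node into the edge below it, the one a downward walk
  uses next.\<close>

lemma orbit_pred:
  fixes i n :: nat
  assumes "i < n"
  shows "{(((\<lambda>j. (j + n - 1) mod n) ^^ k) i + n - 1) mod n | k. True} = {..<n}"
proof -
  let ?f = "\<lambda>j. (j + n - 1) mod n"
  have "j \<in> {?f ((?f ^^ k) i) | k. True}" if "j < n" for j
  proof -
    have iter: "(?f ^^ k) ((j + 1 + k) mod n) = (j + 1) mod n" for k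
    proof (induction k)
      case (Suc k)
      have "?f ((j + 1 + Suc k) mod n) = (j + 1 + k) mod n"
        using mod_Suc_pred[of "(j + 1 + k) mod n" n] assms by (simp add: mod_Suc_eq)
      then show ?case using Suc by (simp add: funpow_swap1 del: funpow.simps add: funpow_Suc_right)
    qed simp
    \<comment> \<open>The number of steps is congruent to \<open>i - (j + 1)\<close> modulo n, so
      the walk from i ends at j + 1.\<close>
    have "(j + 1 + (i + 2 * n - j - 1)) mod n = i"
      using assms that by (simp add: mod_mult_self2)
    then have "(?f ^^ (i + 2 * n - j - 1)) i = (j + 1) mod n"
      using iter[of "i + 2 * n - j - 1"] by simp
    then have "?f ((?f ^^ (i + 2 * n - j - 1)) i) = j"
      using mod_Suc_pred[OF that] by simp
    then show ?thesis by (metis (mono_tags, lifting) mem_Collect_eq)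
  qed
  then show ?thesis using assms by auto
qed

section \<open>The counter invariant for fixed identifiers\<close>

locale pulse_ring =
  fixes n :: nat and w :: "nat \<Rightarrow> port" and ident :: "nat \<Rightarrow> nat"
  assumes n_pos: "0 < n"
begin

text \<open>The pulses on their way to \<open>e\<close> are relayed ones that had arrived at \<open>feeder e\<close>.\<close>

definition feeder :: "nat \<times> port \<Rightarrow> nat \<times> port" where
  "feeder e = (case opposite_end n w e of (j, q) \<Rightarrow> (j, other_port q))"

definition lim :: "nat \<times> port \<Rightarrow> nat" where
  "lim e = limit (ident (fst e)) (snd e)"

text \<open>The summand 1 is the initial pulse; it is offset by the absorbed one from the limit on.\<close>

definition relayed :: "(nat \<times> port \<Rightarrow> nat) \<Rightarrow> nat \<times> port \<Rightarrow> nat" where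
  "relayed r e = r e + (if r e < lim e then 1 else 0)"

text \<open>The port at which node \<open>i\<close> receives the pulses that travel upwards, from \<open>i - 1\<close> to \<open>i\<close>
  (\<open>d = True\<close>), or downwards (\<open>d = False\<close>).\<close>

definition arrival :: "bool \<Rightarrow> nat \<Rightarrow> port" where
  "arrival d i = (if d then other_port (w i) else w i)"

definition top :: "bool \<Rightarrow> nat" where
  "top d = Max ((\<lambda>i. lim (i, arrival d i)) ` {..<n})"

text \<open>Port \<open>w i\<close> receives the downward pulses, so the argument of
  \<open>top\<close> is the direction of the pulses arriving at \<open>e\<close>.\<close>

definition bound :: "nat \<times> port \<Rightarrow> nat" where
  "bound e = top (snd e \<noteq> w (fst e))"

text \<open>\<open>r\<close> records the deliveries at each port. The second conjunct is
  conservation: what was sent towards \<open>e\<close> has arrived or is in transit.\<close>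

definition invariant :: "configuration \<Rightarrow> (nat \<times> port \<Rightarrow> nat) \<Rightarrow> bool" where
  "invariant C r \<longleftrightarrow>
     (\<forall>i<n. memory C i = encode (ident i) (\<lambda>p. r (i, p))) \<and>
     (\<forall>e. fst e < n \<longrightarrow> transit C e + r e = relayed r (feeder e)) \<and>
     (\<forall>e. n \<le> fst e \<longrightarrow> transit C e = 0) \<and>
     sent C = (\<Sum>e\<in>{..<n} \<times> UNIV. relayed r e) \<and>
     (\<forall>e. fst e < n \<longrightarrow> r e \<le> bound e)"

lemma fst_feeder_less: "fst (feeder e) < n"
  using fst_opposite_end_less[OF n_pos, of w e] by (auto simp: feeder_def split: prod.splits)

lemma feeder_eq_iff:
  assumes "fst e < n" "i < n"
  shows "feeder e = (i, p) \<longleftrightarrow> opposite_end n w (i, other_port p) = e"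
proof -
  have "feeder e = (i, p) \<longleftrightarrow> opposite_end n w e = (i, other_port p)"
    by (cases "opposite_end n w e") (auto simp: feeder_def)
  also have "\<dots> \<longleftrightarrow> opposite_end n w (i, other_port p) = e"
    using opposite_end_involution[of e n w] opposite_end_involution[of "(i, other_port p)" n w] assms by auto
  finally show ?thesis .
qed

lemma feeder_arrival:
  assumes "i < n"
  shows "feeder (i, arrival True i) = ((i + n - 1) mod n, arrival True ((i + n - 1) mod n))"
    and "feeder (i, arrival False i) = ((i + 1) mod n, arrival False ((i + 1) mod n))"
  by (simp_all add: feeder_def arrival_def opposite_end_def Let_def)

lemma arrival_cases:
  obtains d where "snd e = arrival d (fst e)"
proof (cases "snd e = w (fst e)")
  case True
  then show ?thesis using that[of False] by (simp add: arrival_def)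
next
  case False
  then have "other_port (w (fst e)) = snd e" by (simp add: other_port_eq_iff)
  then show ?thesis using that[of True] by (simp add: arrival_def)
qed

lemma bound_arrival: "bound (i, arrival d i) = top d"
  by (simp add: bound_def arrival_def)

lemma bound_feeder: "fst e < n \<Longrightarrow> bound (feeder e) = bound e"
proof -
  assume "fst e < n"
  obtain d where "snd e = arrival d (fst e)" by (rule arrival_cases)
  then obtain i where e: "e = (i, arrival d i)" by (metis prod.collapse)
  then have "i < n" using \<open>fst e < n\<close> by simp
  then show ?thesis
    unfolding e by (cases d) (simp_all only: feeder_arrival bound_arrival)
qed

lemma lim_le_top: "i < n \<Longrightarrow> lim (i, arrival d i) \<le> top d"
  by (simp add: top_def)

lemma lim_le_bound: "fst e < n \<Longrightarrow> lim e \<le> bound e"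
proof -
  assume "fst e < n"
  obtain d where "snd e = arrival d (fst e)" by (rule arrival_cases)
  then obtain i where e: "e = (i, arrival d i)" by (metis prod.collapse)
  then show ?thesis using lim_le_top[of i d] \<open>fst e < n\<close> by (simp add: bound_arrival)
qed

text \<open>Below the own limit one extra pulse still fits under it; from the limit on none is
  added. Hence relaying never pushes a counter past the largest limit of its direction.\<close>

lemma relayed_le_bound:
  assumes "fst e < n" "r e \<le> bound e"
  shows "relayed r e \<le> bound e"
  using assms lim_le_bound[of e] by (auto simp: relayed_def)

lemma lim_pos: "0 < lim e"
  by (auto simp: lim_def limit_def split: port.split)

lemma invariant_initial:
  assumes "\<And>i. i < n \<Longrightarrow> I (\<omega> i) = ident i"
  shows "invariant (initial_configuration (relay_alg I) n w \<omega>) (\<lambda>_. 0)"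
proof -
  let ?C = "initial_configuration (relay_alg I) n w \<omega>"
  have em: "emission n w i (\<lambda>_. 1) e = (\<Sum>q\<in>UNIV. if opposite_end n w (i, q) = e then 1 else 0)" for i e
    by (simp add: emission_def UNIV_port)
  have tr: "transit ?C e = (\<Sum>x\<in>{..<n} \<times> UNIV. if opposite_end n w x = e then 1 else 0)" for e
    by (simp add: initial_configuration_def em[simplified] sum.cartesian_product case_prod_unfold)
  have "transit ?C e = 1" if "fst e < n" for e
  proof -
    have "transit ?C e = (\<Sum>x\<in>{..<n} \<times> UNIV. if x = opposite_end n w e then 1 else 0)"
      unfolding tr using that fst_opposite_end_less[OF n_pos] opposite_end_involution[of _ n w]
      by (intro sum.cong) auto
    also have "\<dots> = 1"
      using fst_opposite_end_less[OF n_pos, of w e] by (cases "opposite_end n w e") (simp add: sum.delta)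
    finally show ?thesis .
  qed
  moreover have "transit ?C e = 0" if "n \<le> fst e" for e
    unfolding tr using that fst_opposite_end_less[OF n_pos, of w]
    by (intro sum.neutral ballI) (auto dest: leD)
  moreover have "sent ?C = 2 * n"
    by (simp add: initial_configuration_def)
  moreover have "(\<Sum>e\<in>{..<n} \<times> (UNIV :: port set). 1) = 2 * n"
    by (simp add: card_cartesian_product UNIV_port)
  ultimately show ?thesis
    using assms lim_pos unfolding invariant_def
    by (simp add: relayed_def, simp add: initial_configuration_def)
qed

text \<open>A delivery at \<open>e\<close> raises \<open>relayed\<close> there by \<open>k\<close>,
  which is 0 exactly on reaching the limit, and these \<open>k\<close> pulses go to the only port
  fed by \<open>e\<close>.\<close>

lemma invariant_deliver:
  assumes "invariant C r" "0 < transit C e"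
  shows "invariant (deliver (relay_alg I) n w \<omega> e C) (r(e := Suc (r e)))"
proof -
  obtain i p where e: "e = (i, p)" by fastforce
  define D where "D = deliver (relay_alg I) n w \<omega> e C"
  define r' where "r' = r(e := Suc (r e))"
  define k :: nat where "k = (if Suc (r e) = lim e then 0 else 1)"
  have i: "i < n"
    using assms e unfolding invariant_def by (metis fst_conv less_irrefl not_le)
  have mem: "memory C i = encode (ident i) (\<lambda>p. r (i, p))"
    using assms(1) i by (simp add: invariant_def)
  have upd: "((\<lambda>p. r (i, p))(p := Suc (r (i, p)))) = (\<lambda>q. r' (i, q))"
    by (auto simp: r'_def e)
  have memD: "memory D = (memory C)(i := encode (ident i) (\<lambda>q. r' (i, q)))"
    and trD: "transit D e' = (if e' = e then transit C e' - 1 else transit C e')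
                + (if opposite_end n w (i, other_port p) = e' then k else 0)"
    and sentD: "sent D = sent C + k" for e'
    by (simp_all add: D_def deliver_def e mem Let_def upd[unfolded fun_upd_def] upd emission_single k_def lim_def)
      (cases p; simp)
  have rel: "relayed r' e' = relayed r e' + (if e' = e then k else 0)" for e'
    by (auto simp: relayed_def r'_def k_def)
  \<comment> \<open>The pulse being delivered is among those sent by the feeder, whose number
    respects the common bound of the direction.\<close>
  have "Suc (r e) \<le> bound e"
  proof -
    have "Suc (r e) \<le> relayed r (feeder e)"
    proof -
      have "transit C e + r e = relayed r (feeder e)"
        using assms(1) i e by (simp add: invariant_def)
      then show ?thesis using assms(2) by linarith
    qed
    also have "\<dots> \<le> bound (feeder e)"
      using assms(1) relayed_le_bound[OF fst_feeder_less] fst_feeder_less unfolding invariant_def by blast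
    finally show ?thesis using bound_feeder i e by simp
  qed
  then have "r' e' \<le> bound e'" if "fst e' < n" for e'
  proof (cases "e' = e")
    case False
    then show ?thesis using assms(1) that unfolding invariant_def r'_def by (metis fun_upd_other)
  qed (simp add: r'_def)
  moreover have "transit D e' + r' e' = relayed r' (feeder e')" if "fst e' < n" for e'
  proof -
    have "transit C e' + r e' = relayed r (feeder e')"
      using assms(1) that unfolding invariant_def by blast
    moreover have "feeder e' = e \<longleftrightarrow> opposite_end n w (i, other_port p) = e'"
      using feeder_eq_iff[OF that i] e by simp
    moreover have "(if e' = e then transit C e' - 1 else transit C e') + r' e' = transit C e' + r e'"
      using assms(2) by (auto simp: r'_def)
    ultimately show ?thesis
      by (simp add: trD rel)
  qed
  moreover have "transit D e' = 0" if "n \<le> fst e'" for e'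
  proof -
    have "opposite_end n w (i, other_port p) \<noteq> e'"
      using fst_opposite_end_less[OF n_pos, of w "(i, other_port p)"] that by auto
    moreover have "transit C e' = 0"
      using assms(1) that unfolding invariant_def by blast
    ultimately show ?thesis using that i e by (auto simp: trD)
  qed
  moreover have "sent D = (\<Sum>e\<in>{..<n} \<times> UNIV. relayed r' e)"
    using assms(1) i e by (simp add: sentD rel sum.distrib invariant_def)
  moreover have "memory D j = encode (ident j) (\<lambda>p. r' (j, p))" if "j < n" for j
    using assms(1) that by (auto simp: memD invariant_def r'_def e)
  ultimately show ?thesis
    unfolding invariant_def D_def[symmetric] r'_def[symmetric] by blast
qed

text \<open>Along the ring the counters can only grow, so once nothing is in transit they agree, and
  no node has still to absorb its pulse.\<close>

lemma quiescent_count: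
  assumes "invariant C r" "quiescent C" "i < n"
  shows "r (i, arrival d i) = top d"
proof -
  define f where "f j = r (j, arrival d j)" for j
  have eq: "f j = relayed r (feeder (j, arrival d j))" if "j < n" for j
    using assms(1,2) that by (auto simp: invariant_def quiescent_def f_def)
  have le_top: "f j \<le> top d" if "j < n" for j
    using assms(1) that bound_arrival[of j d] by (metis fst_conv f_def invariant_def)
  have const: "f j = f i" if "j < n" for j
  proof (cases d)
    case True
    have "f l \<le> f ((l + 1) mod n)" if "l < n" for l
    proof -
      have "f ((l + 1) mod n) = relayed r (l, arrival d l)"
        using eq[of "(l + 1) mod n"] feeder_arrival(1)[of "(l + 1) mod n"] mod_Suc_pred[OF that] n_pos True
        by simp
      then show ?thesis by (simp add: relayed_def f_def)
    qed
    then show ?thesis using cyclic_mono_const that assms(3) by blast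
  next
    case False
    have "f ((l + 1) mod n) \<le> f l" if "l < n" for l
      using eq[OF that] feeder_arrival(2)[OF that] False by (simp add: relayed_def f_def)
    \<comment> \<open>Downward counters never grow with the index; reflecting them at
      \<open>top d\<close> reverses this, and \<open>le_top\<close> makes the truncated subtraction
      injective.\<close>
    then have "top d - f j = top d - f i"
      using cyclic_mono_const[where f = "\<lambda>l. top d - f l" and i = j and j = i] that assms(3) diff_le_mono2 by blast
    moreover have "f j \<le> top d" "f i \<le> top d"
      using le_top that assms(3) by blast+
    ultimately show ?thesis by linarith
  qed
  have "lim (j, arrival d j) \<le> f i" if "j < n" for j
  proof -
    obtain l where "l < n" "feeder (l, arrival d l) = (j, arrival d j)"
    proof (cases d)
      case True
      show ?thesis
        using that[of "(j + 1) mod n"] feeder_arrival(1)[of "(j + 1) mod n"] mod_Suc_pred[OF \<open>j < n\<close>] n_pos True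
        by simp
    next
      case False
      show ?thesis
        using that[of "(j + n - 1) mod n"] feeder_arrival(2)[of "(j + n - 1) mod n"]
          mod_pred_Suc[OF \<open>j < n\<close>] n_pos False by simp
    qed
    then have "f l = relayed r (j, arrival d j)" using eq by simp
    then show ?thesis
      using const[OF \<open>l < n\<close>] const[OF that] by (auto simp: relayed_def f_def split: if_splits)
  qed
  then have "top d \<le> f i"
    unfolding top_def using n_pos by (subst Max_le_iff) auto
  then show ?thesis using le_top[OF assms(3)] by (simp add: f_def)
qed

lemma sum_count_le:
  assumes "invariant C r"
  shows "(\<Sum>e\<in>{..<n} \<times> UNIV. r e) \<le> (\<Sum>e\<in>{..<n} \<times> UNIV. bound e)"
  using assms by (intro sum_mono) (auto simp: invariant_def)

section \<open>Executions for fixed identifiers\<close>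

context
  fixes I \<omega> \<sigma> C
  assumes ident: "\<And>i. i < n \<Longrightarrow> I (\<omega> i) = ident i"
    and exec: "execution (relay_alg I) n w \<omega> \<sigma> C"
begin

lemma execution_invariant: "\<exists>r. invariant (C t) r"
proof (induction t)
  case 0
  then show ?case using invariant_initial[OF ident] exec by (auto simp: execution_def)
next
  case (Suc t)
  then obtain r where r: "invariant (C t) r" by blast
  show ?case
  proof (cases "quiescent (C t)")
    case True
    then have "C (Suc t) = C t" using exec by (simp add: execution_def)
    then show ?thesis using r by auto
  next
    case False
    then have "0 < transit (C t) (\<sigma> t)" "C (Suc t) = deliver (relay_alg I) n w \<omega> (\<sigma> t) (C t)"
      using exec by (auto simp: execution_def)
    then show ?thesis using invariant_deliver[OF r] by metis
  qed
qed

lemma execution_reaches_quiescence: "\<exists>T. quiescent (C T)"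
proof (rule ccontr)
  \<comment> \<open>Each delivery raises the sum of the bounded counters.\<close>
  assume "\<nexists>T. quiescent (C T)"
  then have step: "0 < transit (C t) (\<sigma> t)" "C (Suc t) = deliver (relay_alg I) n w \<omega> (\<sigma> t) (C t)" for t
    using exec by (auto simp: execution_def)
  have "\<exists>r. invariant (C t) r \<and> (\<Sum>e\<in>{..<n} \<times> UNIV. r e) = t" for t
  proof (induction t)
    case 0
    then show ?case using invariant_initial[OF ident] exec by (auto simp: execution_def)
  next
    case (Suc t)
    then obtain r where r: "invariant (C t) r" "(\<Sum>e\<in>{..<n} \<times> UNIV. r e) = t" by blast
    have "\<not> n \<le> fst (\<sigma> t)"
      using r(1) step(1)[of t] unfolding invariant_def by (metis less_irrefl)
    then have mem: "\<sigma> t \<in> {..<n} \<times> UNIV"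
      by (cases "\<sigma> t") auto
    let ?r = "r(\<sigma> t := Suc (r (\<sigma> t)))"
    have "(\<Sum>e\<in>{..<n} \<times> UNIV. ?r e) = (\<Sum>e\<in>{..<n} \<times> UNIV. r e + (if e = \<sigma> t then 1 else 0))"
      by (intro sum.cong) auto
    also have "\<dots> = Suc t"
      using r(2) mem by (simp add: sum.distrib)
    finally show ?case
      using invariant_deliver[OF r(1) step(1)] step(2) by metis
  qed
  \<comment> \<open>One delivery more than the bounds add up to.\<close>
  then obtain r where "invariant (C (Suc (\<Sum>e\<in>{..<n} \<times> UNIV. bound e))) r"
    "(\<Sum>e\<in>{..<n} \<times> UNIV. r e) = Suc (\<Sum>e\<in>{..<n} \<times> UNIV. bound e)" by blast
  then show False using sum_count_le by fastforce
qed

text \<open>By the invariant, the pulses sent are the total of \<open>relayed\<close> over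
  \<open>2 * n\<close> ports, and no limit exceeds \<open>2 * m + 2\<close>.\<close>

lemma execution_sent_le:
  assumes "\<And>i. i < n \<Longrightarrow> ident i \<le> m"
  shows "sent (C t) \<le> 2 * n * (2 * m + 2)"
proof -
  obtain r where r: "invariant (C t) r" using execution_invariant by blast
  have "lim (i, p) \<le> 2 * m + 2" if "i < n" for i p
    using assms[OF that] by (auto simp: lim_def limit_def split: port.split)
  then have "top d \<le> 2 * m + 2" for d
    unfolding top_def using n_pos by (subst Max_le_iff) auto
  then have "relayed r e \<le> 2 * m + 2" if "fst e < n" for e
    using relayed_le_bound[of e r] r that unfolding invariant_def bound_def by (meson le_trans)
  then have "(\<Sum>e\<in>{..<n} \<times> UNIV. relayed r e) \<le> of_nat (card ({..<n} \<times> (UNIV :: port set))) * (2 * m + 2)"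
    by (intro sum_bounded_above) auto
  then show ?thesis
    using r by (simp add: invariant_def card_cartesian_product UNIV_port mult_ac)
qed

text \<open>If \<open>m\<close> is the largest identifier and belongs to node \<open>l\<close> alone, then the direction in which
  pulses reach port 1 of \<open>l\<close> ends with all counters at \<open>2 m + 2\<close>. In the other direction node \<open>l\<close>
  still enforces \<open>2 m + 1\<close>, as all other limits are at most \<open>2 m\<close>.\<close>

lemma execution_succeeds:
  assumes l: "l < n" and max: "\<And>j. j < n \<Longrightarrow> j \<noteq> l \<Longrightarrow> ident j < ident l"
  shows "succeeds (relay_alg I) n w C"
proof -
  obtain T where T: "quiescent (C T)" using execution_reaches_quiescence by blast
  obtain r where r: "invariant (C T) r" using execution_invariant by blast
  obtain d where d: "Port1 = arrival d l" using arrival_cases[of "(l, Port1)"] by auto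
  then have d': "Port0 = arrival (\<not> d) l"
    by (cases d) (auto simp: arrival_def dest: arg_cong[of _ _ other_port])
  have top1: "top d = 2 * ident l + 2"
    unfolding top_def
  proof (rule Max_eqI)
    show "2 * ident l + 2 \<in> (\<lambda>i. lim (i, arrival d i)) ` {..<n}"
      using l d by (intro image_eqI[of _ _ l]) (auto simp: lim_def limit_def split: port.splits)
    show "y \<le> 2 * ident l + 2" if "y \<in> (\<lambda>i. lim (i, arrival d i)) ` {..<n}" for y
      using that max less_imp_le by (fastforce simp: lim_def limit_def split: port.splits)
  qed simp
  have top0: "top (\<not> d) = 2 * ident l + 1"
    unfolding top_def
  proof (rule Max_eqI)
    show "2 * ident l + 1 \<in> (\<lambda>i. lim (i, arrival (\<not> d) i)) ` {..<n}"
      using l d' by (intro image_eqI[of _ _ l]) (auto simp: lim_def limit_def split: port.splits)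
    show "y \<le> 2 * ident l + 1" if y: "y \<in> (\<lambda>i. lim (i, arrival (\<not> d) i)) ` {..<n}" for y
    proof -
      obtain i where i: "i < n" "y = lim (i, arrival (\<not> d) i)" using y by blast
      show ?thesis
      proof (cases "i = l")
        case True
        then show ?thesis using i d' by (simp add: lim_def limit_def split: port.splits)
      next
        case False
        then have "ident i < ident l" using max i by blast
        then show ?thesis using i by (auto simp: lim_def limit_def split: port.split)
      qed
    qed
  qed simp
  have mem: "memory (C T) i = encode (ident i) (\<lambda>p. r (i, p))" if "i < n" for i
    using r that by (simp add: invariant_def)
  have cnt: "r (i, arrival d i) = 2 * ident l + 2" "r (i, other_port (arrival d i)) = 2 * ident l + 1"
    if "i < n" for i
    using quiescent_count[OF r T that, of d] quiescent_count[OF r T that, of "\<not> d"] top0 top1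
    by (cases d; simp add: arrival_def)+
  have "leader_elected (relay_alg I) n (C T)"
    unfolding leader_elected_def
  proof (intro exI[of _ l] conjI allI impI)
    show "role_of (relay_alg I) (memory (C T) l) = Leader"
      using cnt[OF l] d[symmetric] by (simp add: mem[OF l] limit_def)
    show "role_of (relay_alg I) (memory (C T) i) = NonLeader" if "i < n" "i \<noteq> l" for i
    proof -
      have "ident i < ident l" using max that by blast
      moreover have "r (i, Port1) \<ge> 2 * ident l + 1"
        using cnt[OF that(1)] by (cases "arrival d i") auto
      ultimately show ?thesis using that by (simp add: mem limit_def)
    qed
  qed (fact l)
  moreover have cw: "clockwise_ports (relay_alg I) (memory (C T) i) = {other_port (arrival d i)}" if "i < n" for i
    using cnt[OF that] by (cases "arrival d i") (auto simp: mem[OF that])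
  have "oriented (relay_alg I) n w (C T)"
  proof -
    let ?nb = "clockwise_neighbour (relay_alg I) n w (C T)"
    \<comment> \<open>The clockwise walk follows the pulses with the larger count, upwards if
      \<open>d\<close> and downwards otherwise.\<close>
    let ?f = "\<lambda>j. if d then (j + 1) mod n else (j + n - 1) mod n"
    have ce: "clockwise_end (relay_alg I) (C T) i = (i, other_port (arrival d i))" if "i < n" for i
      using cw[OF that] by (simp add: clockwise_end_def)
    have nb: "?nb i = ?f i" if "i < n" for i
      using ce[OF that] by (auto simp: clockwise_neighbour_def opposite_end_def arrival_def Let_def)
    have iter: "(?nb ^^ k) i = (?f ^^ k) i \<and> (?f ^^ k) i < n" if "i < n" for i k
      using that n_pos by (induction k) (auto simp: nb)
    have edge: "edge_at n w (clockwise_end (relay_alg I) (C T) i) = (if d then i else (i + n - 1) mod n)" if "i < n" for i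
      using ce[OF that] by (auto simp: edge_at_def arrival_def)
    have "{edge_at n w (clockwise_end (relay_alg I) (C T) ((?nb ^^ k) i)) | k. True} = {..<n}" if "i < n" for i
    proof (cases d)
      case True
      then show ?thesis using orbit_Suc[OF that] iter[OF that] by (simp add: edge)
    next
      case False
      then show ?thesis using orbit_pred[OF that] iter[OF that] by (simp add: edge)
    qed
    then show ?thesis unfolding oriented_def using cw by blast
  qed
  ultimately show ?thesis
    using T by (auto simp: succeeds_def)
qed

end

end

section \<open>Random identifiers\<close>

interpretation tape: product_prob_space "\<lambda>_ :: nat. measure_pmf (bernoulli_pmf (1/2))" UNIV
  by unfold_locales

interpretation tape_space: prob_space tape_space
  unfolding tape_space_def by (rule tape.prob_space_axioms)

lemma space_tape_space [simp]: "space tape_space = UNIV"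
  by (simp add: tape_space_def space_PiM)

lemma sets_random_space_Collect:
  assumes "finite J" "J \<subseteq> {..<n}" "\<And>j. j \<in> J \<Longrightarrow> A j \<in> sets tape_space"
  shows "{\<omega> \<in> space (random_space n). \<forall>j\<in>J. \<omega> j \<in> A j} \<in> sets (random_space n)"
proof (rule sets.sets_Collect_finite_All[OF _ assms(1)])
  fix j assume j: "j \<in> J"
  then have "(\<lambda>\<omega>. \<omega> j) \<in> random_space n \<rightarrow>\<^sub>M tape_space"
    unfolding random_space_def using assms(2) by (intro measurable_component_singleton) blast
  from measurable_sets[OF this assms(3)[OF j]]
  show "{\<omega> \<in> space (random_space n). \<omega> j \<in> A j} \<in> sets (random_space n)"
    by (simp add: vimage_def Int_def conj_commute)
qed

lemma measure_random_space_Collect: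
  assumes "J \<subseteq> {..<n}" "\<And>j. j \<in> J \<Longrightarrow> A j \<in> sets tape_space"
  shows "measure (random_space n) {\<omega> \<in> space (random_space n). \<forall>j\<in>J. \<omega> j \<in> A j}
           = (\<Prod>j\<in>J. measure tape_space (A j))"
proof -
  interpret product_prob_space "\<lambda>_ :: nat. tape_space" "{..<n}"
    by unfold_locales
  have "finite J" using assms(1) finite_subset by blast
  then have "emeasure (random_space n) {\<omega> \<in> space (random_space n). \<forall>j\<in>J. \<omega> j \<in> A j}
           = (\<Prod>j\<in>J. emeasure tape_space (A j))"
    unfolding random_space_def by (intro emeasure_PiM_Collect assms)
  then show ?thesis
    unfolding tape_space.emeasure_eq_measure
    by (subst (asm) prod_ennreal) (simp_all add: measure_def prod_nonneg)
qed

lemma prob_space_random_space: "prob_space (random_space n)"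
  unfolding random_space_def by (intro prob_space_PiM tape_space.prob_space_axioms)

lemma measurable_tape [measurable]: "(\<lambda>\<tau>. \<tau> k) \<in> tape_space \<rightarrow>\<^sub>M count_space UNIV"
proof -
  have "(\<lambda>\<tau>. \<tau> k) \<in> tape_space \<rightarrow>\<^sub>M measure_pmf (bernoulli_pmf (1/2))"
    unfolding tape_space_def by (rule measurable_component_singleton) simp
  then show ?thesis by simp
qed

lemma measure_tape_cylinder:
  assumes "finite J"
  shows "measure tape_space {\<tau>. \<forall>j\<in>J. \<tau> j = b j} = (1/2) ^ card J"
proof -
  have "pmf (bernoulli_pmf (1/2)) x = 1/2" for x
    by (cases x) simp_all
  then have "emeasure tape_space {\<tau> \<in> space tape_space. \<forall>j\<in>J. \<tau> j \<in> {b j}} = (\<Prod>j\<in>J. ennreal (1/2))"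
    unfolding tape_space_def using assms
    by (subst tape.emeasure_PiM_Collect) (simp_all add: emeasure_pmf_single del: prod_constant)
  also have "\<dots> = ennreal ((1/2) ^ card J)"
    by (subst prod_ennreal) simp_all
  finally show ?thesis
    by (simp add: measure_def)
qed

lemma sets_tape_cylinder:
  assumes "finite J"
  shows "{\<tau>. \<forall>j\<in>J. \<tau> j = b j} \<in> sets tape_space"
proof -
  have "{\<tau> \<in> space tape_space. \<forall>j\<in>J. \<tau> j = b j} \<in> sets tape_space"
    using assms by (intro sets.sets_Collect_finite_All) measurable
  then show ?thesis by simp
qed

section \<open>The distribution of one identifier\<close>

text \<open>The length of an identifier is a multiple of a geometric random variable read off the even
  positions of the tape, its bits are read off the odd positions.\<close>

definition run :: "tape \<Rightarrow> nat" where
  "run \<tau> = (if \<exists>k. \<not> \<tau> (2 * k) then LEAST k. \<not> \<tau> (2 * k) else 0)"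

text \<open>The leading power of two marks the length, so bit strings of different lengths never
  collide.\<close>

definition random_id :: "nat \<Rightarrow> tape \<Rightarrow> nat" where
  "random_id L \<tau> = 2 ^ (L * run \<tau>) + horner_sum of_bool 2 (map (\<lambda>j. \<tau> (2 * j + 1)) [0..<L * run \<tau>])"

lemma measurable_run [measurable]: "run \<in> tape_space \<rightarrow>\<^sub>M count_space UNIV"
  unfolding run_def by measurable

lemma measurable_random_id [measurable]: "random_id L \<in> tape_space \<rightarrow>\<^sub>M count_space UNIV"
proof -
  have "(\<lambda>\<tau>. 2 ^ (L * g) + (\<Sum>j = 0..<L * g. of_bool (\<tau> (2 * j + 1)) * 2 ^ j) :: nat)
          \<in> tape_space \<rightarrow>\<^sub>M count_space UNIV" for g
    by measurable
  then have "(\<lambda>\<tau>. 2 ^ (L * run \<tau>) + (\<Sum>j = 0..<L * run \<tau>. of_bool (\<tau> (2 * j + 1)) * 2 ^ j) :: nat)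
          \<in> tape_space \<rightarrow>\<^sub>M count_space UNIV"
    by (rule measurable_compose_countable) measurable
  then show ?thesis
    by (simp add: random_id_def[abs_def] horner_sum_eq_sum)
qed

lemma random_id_bounds: "2 ^ (L * run \<tau>) \<le> random_id L \<tau>" "random_id L \<tau> < 2 ^ (L * run \<tau> + 1)"
  using horner_sum_of_bool_2_less[of "map (\<lambda>j. \<tau> (2 * j + 1)) [0..<L * run \<tau>]", where 'a = nat]
  by (simp_all add: random_id_def)

lemma le_run:
  assumes "2 ^ (L * j) \<le> random_id L \<tau>" "0 < L"
  shows "j \<le> run \<tau>"
proof -
  have "2 ^ (L * j) < (2 :: nat) ^ (L * run \<tau> + 1)"
    using assms(1) random_id_bounds(2)[of L \<tau>] by linarith
  then have "L * j < L * run \<tau> + 1" by (rule power_less_imp_less_exp[rotated]) simp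
  then have "L * j \<le> L * run \<tau>" by linarith
  then show ?thesis using assms(2) by simp
qed

text \<open>Different values of \<open>run\<close> lead to disjoint dyadic intervals; for equal ones
  the leading powers cancel and the Horner sum returns the bits.\<close>

lemma random_id_inject:
  assumes eq: "random_id L \<tau> = random_id L \<tau>'" and "0 < L"
  shows "run \<tau> = run \<tau>'" and "j < L * run \<tau> \<Longrightarrow> \<tau> (2 * j + 1) = \<tau>' (2 * j + 1)"
proof -
  show run: "run \<tau> = run \<tau>'"
    using random_id_bounds(1)[of L \<tau>] random_id_bounds(1)[of L \<tau>'] eq assms(2)
    by (metis le_antisym le_run)
  let ?bits = "\<lambda>\<tau>'. map (\<lambda>j. \<tau>' (2 * j + 1)) [0..<L * run \<tau>]"
  have "horner_sum of_bool 2 (?bits \<tau>) = (horner_sum of_bool 2 (?bits \<tau>') :: nat)"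
    using eq run by (simp add: random_id_def)
  then have "bit (horner_sum of_bool 2 (?bits \<tau>) :: nat) j = bit (horner_sum of_bool 2 (?bits \<tau>') :: nat) j"
    by (rule arg_cong)
  then show "\<tau> (2 * j + 1) = \<tau>' (2 * j + 1)" if "j < L * run \<tau>"
    using that by (simp add: bit_horner_sum_bit_iff)
qed

text \<open>All tapes with identifier x agree with one of them, \<open>\<tau>\<close>, at its
  \<open>L * run \<tau>\<close> bit positions, and the size of x forces
  \<open>k \<le> run \<tau>\<close>.\<close>

lemma prob_random_id_eq:
  assumes "2 ^ (L * k) \<le> x" "0 < L"
  shows "measure tape_space (random_id L -` {x}) \<le> (1/2) ^ (L * k)"
proof (cases "\<exists>\<tau>. random_id L \<tau> = x")
  case True
  then obtain \<tau> where \<tau>: "random_id L \<tau> = x" by blast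
  let ?J = "(\<lambda>j. 2 * j + 1) ` {..<L * run \<tau>}"
  have "random_id L -` {x} \<subseteq> {\<tau>'. \<forall>j\<in>?J. \<tau>' j = \<tau> j}"
  proof (intro subsetI CollectI ballI)
    fix \<tau>' i assume "\<tau>' \<in> random_id L -` {x}" "i \<in> ?J"
    then obtain j where "random_id L \<tau>' = x" "j < L * run \<tau>" "i = 2 * j + 1" by auto
    then show "\<tau>' i = \<tau> i"
      using random_id_inject(2)[of L \<tau> \<tau>' j] \<tau> assms(2) by metis
  qed
  then have "measure tape_space (random_id L -` {x}) \<le> measure tape_space {\<tau>'. \<forall>j\<in>?J. \<tau>' j = \<tau> j}"
    by (intro tape_space.finite_measure_mono sets_tape_cylinder) simp_all
  also have "\<dots> = (1/2) ^ card ?J"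
    by (rule measure_tape_cylinder) simp
  also have "card ?J = L * run \<tau>"
    by (subst card_image) (auto simp: inj_on_def)
  also have "(1/2 :: real) ^ (L * run \<tau>) \<le> (1/2) ^ (L * k)"
    using le_run[of L k \<tau>] \<tau> assms by (intro power_decreasing) auto
  finally show ?thesis .
next
  case False
  then have "random_id L -` {x} = {}" by auto
  then show ?thesis by simp
qed

text \<open>Tapes whose even positions begin with k heads and a tail have \<open>run\<close> equal
  to k; they form a cylinder on k + 1 coins, disjoint from the event.\<close>

lemma prob_random_id_less:
  "measure tape_space (random_id L -` {..<2 ^ (L * k)}) \<le> 1 - (1/2) ^ (k + 1)"
proof -
  let ?A = "{\<tau>. \<forall>j\<in>(*) 2 ` {..k}. \<tau> j = (j \<noteq> 2 * k)}"
  have "run \<tau> = k" if "\<tau> \<in> ?A" for \<tau>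
  proof -
    have "\<not> \<tau> (2 * k)" "\<And>j. j < k \<Longrightarrow> \<tau> (2 * j)" using that by auto
    then show ?thesis
      unfolding run_def by (auto intro!: Least_equality) (meson not_le)
  qed
  then have "2 ^ (L * k) \<le> random_id L \<tau>" if "\<tau> \<in> ?A" for \<tau>
    using random_id_bounds(1)[of L \<tau>] that by auto
  then have "random_id L -` {..<2 ^ (L * k)} \<subseteq> space tape_space - ?A"
    by (auto dest!: leD)
  then have "measure tape_space (random_id L -` {..<2 ^ (L * k)}) \<le> measure tape_space (space tape_space - ?A)"
    by (intro tape_space.finite_measure_mono sets.compl_sets sets_tape_cylinder) auto
  also have "\<dots> = 1 - (1/2) ^ card ((*) 2 ` {..k} :: nat set)"
    by (subst tape_space.prob_compl[OF sets_tape_cylinder]) (simp_all only: finite_imageI finite_atMost measure_tape_cylinder)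
  also have "card ((*) 2 ` {..k} :: nat set) = k + 1"
    by (subst card_image) (auto simp: inj_on_def)
  finally show ?thesis .
qed

text \<open>So large an identifier forces \<open>k < run \<tau>\<close>, hence heads at the first k
  + 1 even positions.\<close>

lemma prob_random_id_greater:
  "measure tape_space (random_id L -` {2 ^ (L * k + 1)<..}) \<le> (1/2) ^ (k + 1)"
proof -
  let ?J = "(*) 2 ` {..k} :: nat set"
  have "\<tau> (2 * j)" if "random_id L \<tau> > 2 ^ (L * k + 1)" "j \<le> k" for \<tau> j
  proof -
    have "2 ^ (L * k + 1) < (2 :: nat) ^ (L * run \<tau> + 1)"
      using that(1) random_id_bounds(2)[of L \<tau>] by linarith
    then have "L * k + 1 < L * run \<tau> + 1" by (rule power_less_imp_less_exp[rotated]) simp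
    then have "L * k < L * run \<tau>" by simp
    then have "j < run \<tau>" using that(2) by simp
    \<comment> \<open>Being larger than j, \<open>run \<tau>\<close> is not the default 0 but a
      genuine least index.\<close>
    then show ?thesis
      unfolding run_def by (auto dest: not_less_Least split: if_splits)
  qed
  then have "measure tape_space (random_id L -` {2 ^ (L * k + 1)<..})
      \<le> measure tape_space {\<tau>. \<forall>j\<in>?J. \<tau> j = True}"
    by (intro tape_space.finite_measure_mono sets_tape_cylinder) auto
  also have "\<dots> = (1/2) ^ card ?J"
    by (rule measure_tape_cylinder) simp
  also have "card ?J = k + 1"
    by (subst card_image) (auto simp: inj_on_def)
  finally show ?thesis .
qed

section \<open>A unique maximum among all identifiers\<close>

text \<open>There are only countably many identifier vectors, and each fixes a measurable box. This
  handles even events that quantify over all executions.\<close>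

lemma sets_random_space_ids:
  assumes I: "I \<in> tape_space \<rightarrow>\<^sub>M count_space UNIV"
    and Q: "\<And>\<omega> \<omega>'. \<omega> \<in> space (random_space n) \<Longrightarrow> \<omega>' \<in> space (random_space n) \<Longrightarrow>
              (\<And>i. i < n \<Longrightarrow> I (\<omega> i) = (I (\<omega>' i) :: nat)) \<Longrightarrow> Q \<omega> \<Longrightarrow> Q \<omega>'"
  shows "{\<omega> \<in> space (random_space n). Q \<omega>} \<in> sets (random_space n)"
proof -
  let ?f = "\<lambda>\<omega>. map (\<lambda>i. I (\<omega> i)) [0..<n]"
  let ?S = "?f ` {\<omega> \<in> space (random_space n). Q \<omega>}"
  let ?B = "\<lambda>xs. {\<omega> \<in> space (random_space n). \<forall>i\<in>{..<n}. \<omega> i \<in> I -` {xs ! i}}"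
  have "{\<omega> \<in> space (random_space n). Q \<omega>} = (\<Union>xs\<in>?S. ?B xs)"
  proof (intro equalityI subsetI)
    fix \<omega>' assume "\<omega>' \<in> (\<Union>xs\<in>?S. ?B xs)"
    then obtain \<omega> where "\<omega> \<in> space (random_space n)" "Q \<omega>" "\<omega>' \<in> space (random_space n)"
      "\<And>i. i < n \<Longrightarrow> I (\<omega>' i) = I (\<omega> i)" by auto
    then show "\<omega>' \<in> {\<omega> \<in> space (random_space n). Q \<omega>}" using Q[of \<omega> \<omega>'] by simp
  qed auto
  moreover have "I -` {x} \<in> sets tape_space" for x
    using measurable_sets[OF I, of "{x}"] by simp
  then have "?B xs \<in> sets (random_space n)" for xs
    by (intro sets_random_space_Collect) auto
  then have "(\<Union>xs\<in>?S. ?B xs) \<in> sets (random_space n)"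
    by (intro sets.countable_UN'') auto
  ultimately show ?thesis by argo
qed

text \<open>Without a unique maximum that is at most \<open>m\<close>, all values are below \<open>a\<close> (probability at most
  \<open>(1 - p)\<^sup>n\<close>), or two nodes share a value in \<open>{a..m}\<close>, or some value exceeds \<open>m\<close>.\<close>

lemma prob_unique_maximum:
  fixes I :: "tape \<Rightarrow> nat" and p q u :: real
  assumes I: "I \<in> tape_space \<rightarrow>\<^sub>M count_space UNIV" and n: "0 < n"
    and p: "measure tape_space (I -` {..<a}) \<le> 1 - p"
    and q: "\<And>x. a \<le> x \<Longrightarrow> measure tape_space (I -` {x}) \<le> q"
    and u: "measure tape_space (I -` {m<..}) \<le> u"
  shows "measure (random_space n)
      {\<omega> \<in> space (random_space n). (\<exists>l<n. \<forall>j<n. j \<noteq> l \<longrightarrow> I (\<omega> j) < I (\<omega> l)) \<and> (\<forall>j<n. I (\<omega> j) \<le> m)}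
    \<ge> 1 - ((1 - p) ^ n + real n ^ 2 * q + real n * u)"
    (is "measure ?M ?G \<ge> _")
proof -
  interpret M: prob_space ?M by (rule prob_space_random_space)
  have sets: "I -` X \<in> sets tape_space" for X
    using measurable_sets[OF I, of X] by simp
  have G: "?G \<in> sets ?M"
    by (rule sets_random_space_ids[OF I]) auto
  let ?C = "\<lambda>J X. {\<omega> \<in> space ?M. \<forall>i\<in>J. \<omega> i \<in> I -` X}"
  let ?P = "{(i, j). i < n \<and> j < n \<and> i \<noteq> j}"
  define B1 where "B1 = ?C {..<n} {..<a}"
  define B2 where "B2 = (\<Union>(i, j)\<in>?P. \<Union>x\<in>{a..m}. ?C {i, j} {x})"
  define B3 where "B3 = (\<Union>i\<in>{..<n}. ?C {i} {m<..})"
  have C: "?C J X \<in> sets ?M" if "finite J" "J \<subseteq> {..<n}" for J X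
    using that by (intro sets_random_space_Collect sets)
  have measure_C: "measure ?M (?C J X) = measure tape_space (I -` X) ^ card J" if "J \<subseteq> {..<n}" for J X
    using measure_random_space_Collect[OF that, of "\<lambda>_. I -` X"] sets by simp
  have finP: "finite ?P"
    by (rule finite_subset[of _ "{..<n} \<times> {..<n}"]) auto
  have cardP: "card ?P \<le> n ^ 2"
    using card_mono[of "{..<n} \<times> {..<n}" ?P] by (auto simp: power2_eq_square)
  have CP: "(\<Union>x\<in>{a..m}. ?C {i, j} {x}) \<in> sets ?M" if "(i, j) \<in> ?P" for i j
    using that by (intro sets.finite_UN C) auto
  have B1: "B1 \<in> sets ?M"
    unfolding B1_def by (rule C) simp_all
  have B2: "B2 \<in> sets ?M"
    unfolding B2_def by (rule sets.finite_UN[OF finP]) (auto simp only: split_paired_all case_prod_conv intro!: CP)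
  have B3: "B3 \<in> sets ?M"
    unfolding B3_def by (intro sets.finite_UN C) simp_all
  have "space ?M - ?G \<subseteq> B1 \<union> B2 \<union> B3"
  proof
    fix \<omega> assume \<omega>: "\<omega> \<in> space ?M - ?G"
    show "\<omega> \<in> B1 \<union> B2 \<union> B3"
    proof (rule ccontr)
      assume no: "\<omega> \<notin> B1 \<union> B2 \<union> B3"
      then have le: "I (\<omega> j) \<le> m" if "j < n" for j
        using \<omega> that by (auto simp: B3_def not_less)
      \<comment> \<open>Outside \<open>B1\<close> some value reaches a, so the maximum lies in
        \<open>{a..m}\<close>; if it is shared, \<open>B2\<close> occurs.\<close>
      obtain i where i: "i < n" "a \<le> I (\<omega> i)"
        using no \<omega> by (auto simp: B1_def not_less)
      let ?X = "(\<lambda>i. I (\<omega> i)) ` {..<n}"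
      have "Max ?X \<in> ?X" using n by (intro Max_in) auto
      then obtain l where l: "l < n" "I (\<omega> l) = Max ?X" by auto
      then have max: "I (\<omega> j) \<le> I (\<omega> l)" if "j < n" for j using that by simp
      obtain j where j: "j < n" "j \<noteq> l" "I (\<omega> j) = I (\<omega> l)"
        using \<omega> l(1) le max by (smt (verit) DiffD1 DiffD2 mem_Collect_eq nat_less_le)
      have "\<omega> \<in> B2"
        unfolding B2_def using \<omega> j l(1) le[OF l(1)] order_trans[OF i(2) max[OF i(1)]]
        by (intro UN_I[of "(l, j)"]) simp_all
      then show False using no by simp
    qed
  qed
  then have "measure ?M (space ?M - ?G) \<le> measure ?M (B1 \<union> B2 \<union> B3)"
    by (intro M.finite_measure_mono sets.Un B1 B2 B3)
  also have "\<dots> \<le> measure ?M B1 + measure ?M B2 + measure ?M B3"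
    using measure_Un_le[OF sets.Un[OF B1 B2] B3] measure_Un_le[OF B1 B2]
    by linarith
  also have "measure ?M B1 \<le> (1 - p) ^ n"
    unfolding B1_def measure_C[OF order_refl] card_lessThan using p by (intro power_mono) simp_all
  also have "measure ?M B3 \<le> (\<Sum>i<n. measure ?M (?C {i} {m<..}))"
    unfolding B3_def by (intro M.finite_measure_subadditive_finite image_subsetI C) simp_all
  also have "\<dots> \<le> (\<Sum>i<n. u)"
    using u by (intro sum_mono, subst measure_C) simp_all
  also have "measure ?M B2 \<le> (\<Sum>ij\<in>?P. measure ?M (case ij of (i, j) \<Rightarrow> \<Union>x\<in>{a..m}. ?C {i, j} {x}))"
    unfolding B2_def
    by (intro M.finite_measure_subadditive_finite finP image_subsetI)
      (auto simp only: split_paired_all case_prod_conv intro!: CP)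
  \<comment> \<open>By independence two nodes share x with probability
    \<open>?p x * ?p x \<le> q * ?p x\<close>, and the \<open>?p x\<close> sum to at most 1. Hence m
    does not enter the bound.\<close>
  also have "\<dots> \<le> (\<Sum>ij\<in>?P. q)"
  proof (intro sum_mono, clarify)
    fix i j assume ij: "i < n" "j < n" "i \<noteq> j"
    let ?p = "\<lambda>x. measure tape_space (I -` {x})"
    have "measure ?M (\<Union>x\<in>{a..m}. ?C {i, j} {x}) \<le> (\<Sum>x\<in>{a..m}. measure ?M (?C {i, j} {x}))"
      using ij by (intro M.finite_measure_subadditive_finite image_subsetI C) simp_all
    also have "\<dots> = (\<Sum>x\<in>{a..m}. ?p x * ?p x)"
      using ij by (intro sum.cong refl, subst measure_C) (auto simp: power2_eq_square)
    also have "\<dots> \<le> (\<Sum>x\<in>{a..m}. q * ?p x)"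
      using q by (intro sum_mono mult_right_mono) auto
    also have "\<dots> = q * measure tape_space (\<Union>x\<in>{a..m}. I -` {x})"
      unfolding sum_distrib_left[symmetric] using sets
      by (subst tape_space.finite_measure_finite_Union) (auto simp: disjoint_family_on_def)
    also have "\<dots> \<le> q * 1"
      using order_trans[OF measure_nonneg q[OF order_refl]]
      by (intro mult_left_mono tape_space.prob_le_1)
    finally show "measure ?M (\<Union>x\<in>{a..m}. ?C {i, j} {x}) \<le> q" by simp
  qed
  also have "\<dots> \<le> real n ^ 2 * q"
    using cardP order_trans[OF measure_nonneg q[OF order_refl]]
    by (simp add: mult_right_mono flip: of_nat_power)
  finally have "measure ?M (space ?M - ?G) \<le> (1 - p) ^ n + real n ^ 2 * q + real n * u"
    by simp
  then show ?thesis using M.prob_compl[OF G] by simp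
qed

section \<open>Choice of the parameters\<close>

lemma ex_log2_nat:
  fixes x :: real
  assumes "1 \<le> x"
  obtains k :: nat where "2 ^ k \<le> x" "x < 2 ^ (k + 1)"
proof -
  define k where "k = nat \<lfloor>log 2 x\<rfloor>"
  have k: "real k \<le> log 2 x" "log 2 x < real k + 1"
    using assms by (simp_all add: k_def)
  have "2 powr real k \<le> x" "x < 2 powr (real k + 1)"
    using k assms by (simp_all add: le_log_iff log_less_iff)
  then show ?thesis using that[of k] by (simp add: powr_realpow powr_add)
qed

text \<open>A sequence tending to 0 is bounded, which yields one constant for every n.\<close>

lemma exp_sqrt_decay:
  fixes c :: real
  obtains K where "0 < K" "\<And>n :: nat. 1 \<le> n \<Longrightarrow> exp (- sqrt (real n) / 2) \<le> K * real n powr (- c)"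
proof -
  have "(\<lambda>n :: nat. exp (- sqrt n / 2) * n powr c) \<longlonglongrightarrow> 0"
    by real_asymp
  then have "Bseq (\<lambda>n :: nat. exp (- sqrt n / 2) * n powr c)"
    by (intro convergent_imp_Bseq convergentI)
  then obtain K where "0 < K" and K: "\<And>n :: nat. norm (exp (- sqrt n / 2) * n powr c) \<le> K"
    by (auto elim: BseqE)
  show ?thesis
  proof (rule that[OF \<open>0 < K\<close>])
    show "exp (- sqrt (real n) / 2) \<le> K * real n powr (- c)" if "1 \<le> n" for n :: nat
      using K[of n] that by (simp add: powr_minus divide_simps)
  qed
qed

lemma prob_random_ids:
  fixes c :: real
  assumes "0 < c"
  obtains L d :: nat and K :: real where
    "\<And>n. 1 \<le> n \<Longrightarrow> measure (random_space n)
      {\<omega> \<in> space (random_space n).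
         (\<exists>l<n. \<forall>j<n. j \<noteq> l \<longrightarrow> random_id L (\<omega> j) < random_id L (\<omega> l)) \<and>
         (\<forall>j<n. random_id L (\<omega> j) \<le> 2 * n ^ d)}
     \<ge> 1 - K * n powr (- c)"
proof -
  \<comment> \<open>With \<open>2 ^ k\<close> near \<open>sqrt n\<close>, a value is hit with
    probability about \<open>n powr (- L / 2)\<close> at most; this has to outweigh the
    \<open>n ^ 2\<close> pairs.\<close>
  define L where "L = nat \<lceil>2 * (c + 2)\<rceil>"
  \<comment> \<open>One node exceeds the upper limit with probability below
    \<open>n powr (- N)\<close>, summed over n nodes.\<close>
  define N where "N = nat \<lceil>c + 1\<rceil>"
  have L: "2 * (c + 2) \<le> L"
    unfolding L_def by (rule of_nat_ceiling)
  have N: "c + 1 \<le> N"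
    unfolding N_def by (rule of_nat_ceiling)
  have "0 < L" using L assms by (cases L) auto
  obtain K where K: "0 < K" "\<And>n :: nat. 1 \<le> n \<Longrightarrow> exp (- sqrt (real n) / 2) \<le> K * real n powr (- c)"
    by (rule exp_sqrt_decay[where c = c], rule that)
  have "measure (random_space n)
      {\<omega> \<in> space (random_space n).
         (\<exists>l<n. \<forall>j<n. j \<noteq> l \<longrightarrow> random_id L (\<omega> j) < random_id L (\<omega> l)) \<and>
         (\<forall>j<n. random_id L (\<omega> j) \<le> 2 * n ^ (N * L))}
     \<ge> 1 - (K + 2 ^ L + 1) * n powr (- c)" (is "measure ?M ?G \<ge> _") if n: "1 \<le> n" for n
  proof -
    interpret M: prob_space ?M by (rule prob_space_random_space)
    \<comment> \<open>A node reaches \<open>2 ^ (L * k)\<close> with probability at least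
      \<open>(1/2) ^ (k + 1) \<ge> 1 / (2 * sqrt n)\<close>, so all n nodes miss it with probability
      at most \<open>exp (- sqrt n / 2)\<close>.\<close>
    obtain k where k: "2 ^ k \<le> sqrt n" "sqrt n < 2 ^ (k + 1)"
      using ex_log2_nat[of "sqrt n"] n by auto
    obtain h where h: "2 ^ h \<le> real n ^ N" "real n ^ N < 2 ^ (h + 1)"
      using ex_log2_nat[of "real n ^ N"] n by auto
    let ?G' = "{\<omega> \<in> space ?M.
         (\<exists>l<n. \<forall>j<n. j \<noteq> l \<longrightarrow> random_id L (\<omega> j) < random_id L (\<omega> l)) \<and>
         (\<forall>j<n. random_id L (\<omega> j) \<le> 2 ^ (L * h + 1))}"
    have "(2 ^ h) ^ L \<le> (n ^ N) ^ L"
      using h(1) by (intro power_mono) (simp_all flip: of_nat_le_iff[where 'a = real])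
    then have "2 ^ (L * h + 1) \<le> 2 * n ^ (N * L)"
      by (simp add: power_mult mult.commute[of L h])
    then have "?G' \<subseteq> ?G" by (auto intro: order_trans)
    moreover have "?G \<in> sets ?M"
      by (rule sets_random_space_ids[OF measurable_random_id[of L]]) auto
    ultimately have mono: "measure ?M ?G' \<le> measure ?M ?G"
      by (rule M.finite_measure_mono)
    have "(1 - (1/2) ^ (k + 1) :: real) ^ n \<le> exp (- ((1/2) ^ (k + 1))) ^ n"
      using exp_ge_add_one_self[of "- ((1/2 :: real) ^ (k + 1))"]
      by (intro power_mono) (simp_all add: power_le_one del: power_Suc)
    also have "\<dots> = exp (- (n * (1/2) ^ (k + 1)))"
      by (simp add: exp_of_nat_mult[symmetric])
    also have "\<dots> \<le> exp (- sqrt n / 2)"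
    proof -
      have "sqrt n * 2 ^ k \<le> sqrt n * sqrt n"
        using k(1) by (intro mult_left_mono) auto
      then show ?thesis by (simp add: field_simps)
    qed
    also have "\<dots> \<le> K * n powr (- c)" by (rule K(2)[OF n])
    finally have 1: "(1 - (1/2) ^ (k + 1)) ^ n \<le> K * n powr (- c)" .
    have 2: "real n ^ 2 * (1/2) ^ (L * k) \<le> 2 ^ L * n powr (- c)"
    proof -
      \<comment> \<open>Rounding \<open>sqrt n\<close> to a power of two loses a factor below 2,
        hence the constant \<open>2 ^ L\<close>.\<close>
      have "(sqrt n / 2) ^ L \<le> (2 ^ k) ^ L"
        using k(2) by (intro power_mono) auto
      then have "sqrt n ^ L \<le> 2 ^ L * 2 ^ (L * k)"
        by (simp add: power_divide field_simps flip: power_mult)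
      moreover have "sqrt n ^ L = n powr (L / 2)"
        using n by (simp add: powr_half_sqrt[symmetric] powr_powr powr_realpow[symmetric])
      moreover have "n powr (c + 2) \<le> n powr (L / 2)"
        using n L by (intro powr_mono) auto
      moreover have "n powr (c + 2) = real n ^ 2 * n powr c"
        using n by (simp add: powr_add)
      ultimately have "real n ^ 2 * n powr c \<le> 2 ^ L * 2 ^ (L * k)" by linarith
      then show ?thesis using n by (simp add: powr_minus field_simps power_divide)
    qed
    have 3: "n * (1/2) ^ (h + 1) \<le> n powr (- c)"
    proof -
      have "n powr (c + 1) \<le> n powr N"
        using n N by (intro powr_mono) auto
      also have "\<dots> = real n ^ N" using n by (simp add: powr_realpow)
      finally have "n powr c * n \<le> 2 ^ (h + 1)"
        using h(2) n by (simp add: powr_add)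
      then show ?thesis using n by (simp add: powr_minus field_simps power_divide)
    qed
    have "1 - ((1 - (1/2) ^ (k + 1)) ^ n + real n ^ 2 * (1/2) ^ (L * k) + n * (1/2) ^ (h + 1))
        \<le> measure ?M ?G'"
      using n \<open>0 < L\<close> prob_random_id_eq prob_random_id_less prob_random_id_greater
      by (intro prob_unique_maximum[where a = "2 ^ (L * k)"] measurable_random_id) auto
    then have "1 - (K * n powr (- c) + 2 ^ L * n powr (- c) + n powr (- c)) \<le> measure ?M ?G'"
      using 1 2 3 by linarith
    then show ?thesis using mono by (simp add: algebra_simps)
  qed
  then show ?thesis by (rule that)
qed

section \<open>Measurability of the algorithm and conclusion\<close>

lemma randomized_algorithm_relay_alg:
  assumes I: "I \<in> tape_space \<rightarrow>\<^sub>M count_space UNIV"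
  shows "randomized_algorithm (relay_alg I)"
proof -
  have "(\<lambda>x. (encode x (\<lambda>_. 0), \<lambda>_ :: port. 1 :: nat)) \<circ> I \<in> tape_space \<rightarrow>\<^sub>M count_space UNIV"
    by (rule measurable_comp[OF I]) simp
  then show ?thesis
    by (simp add: randomized_algorithm_def comp_def)
qed

text \<open>The tape enters only through the identifier at the start. This makes success an event
  about identifiers.\<close>

lemma execution_relay_alg_cong:
  assumes "\<And>i. I (\<omega> i) = I (\<omega>' i)"
  shows "execution (relay_alg I) n w \<omega> = execution (relay_alg I) n w \<omega>'"
proof -
  have "initial_configuration (relay_alg I) n w \<omega> = initial_configuration (relay_alg I) n w \<omega>'"
    by (simp add: initial_configuration_def assms)
  moreover have "deliver (relay_alg I) n w \<omega> = deliver (relay_alg I) n w \<omega>'"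
    by (simp add: deliver_def fun_eq_iff)
  ultimately show ?thesis unfolding execution_def by (simp only:)
qed

theorem theoremB2:
  fixes c :: real
  assumes "c > 0"
  shows "\<exists>A. randomized_algorithm A \<and> elects_whp A c \<and>
           (\<forall>n\<ge>1. \<forall>w. AE \<omega> in random_space n. \<forall>\<sigma> C. execution A n w \<omega> \<sigma> C \<longrightarrow>
              reaches_quiescence C \<and> never_terminates A n C)"
proof -
  obtain L d :: nat and K :: real where prob: "\<And>n. 1 \<le> n \<Longrightarrow> measure (random_space n)
      {\<omega> \<in> space (random_space n).
         (\<exists>l<n. \<forall>j<n. j \<noteq> l \<longrightarrow> random_id L (\<omega> j) < random_id L (\<omega> l)) \<and>
         (\<forall>j<n. random_id L (\<omega> j) \<le> 2 * n ^ d)}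
     \<ge> 1 - K * n powr (- c)"
    by (rule prob_random_ids[OF assms], rule that)
  let ?A = "relay_alg (random_id L)"
  have "measure (random_space n)
          {\<omega> \<in> space (random_space n). \<forall>\<sigma> C. execution ?A n w \<omega> \<sigma> C \<longrightarrow>
             succeeds ?A n w C \<and> message_complexity_le C (12 * real n ^ (d + 1))}
        \<ge> 1 - K * real n powr (- c)" (is "measure ?M ?E \<ge> _") if n: "1 \<le> n" for n w
  proof -
    interpret M: prob_space ?M by (rule prob_space_random_space)
    let ?G = "{\<omega> \<in> space (random_space n).
         (\<exists>l<n. \<forall>j<n. j \<noteq> l \<longrightarrow> random_id L (\<omega> j) < random_id L (\<omega> l)) \<and>
         (\<forall>j<n. random_id L (\<omega> j) \<le> 2 * n ^ d)}"
    have "?E \<in> sets ?M"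
    proof (rule sets_random_space_ids[OF measurable_random_id[of L]])
      fix \<omega> \<omega>'
      assume sp: "\<omega> \<in> space ?M" "\<omega>' \<in> space ?M"
        and eq: "\<And>i. i < n \<Longrightarrow> random_id L (\<omega> i) = random_id L (\<omega>' i)"
        and Q: "\<forall>\<sigma> C. execution ?A n w \<omega> \<sigma> C \<longrightarrow>
             succeeds ?A n w C \<and> message_complexity_le C (12 * real n ^ (d + 1))"
      \<comment> \<open>Configurations also assign memory outside the ring; there both points take
        the default value of the product space.\<close>
      have "\<omega> i = \<omega>' i" if "\<not> i < n" for i
        using sp that by (auto simp: random_space_def space_PiM PiE_def extensional_def)
      then have "random_id L (\<omega> i) = random_id L (\<omega>' i)" for i
        using eq by (cases "i < n") auto
      then have "execution ?A n w \<omega> = execution ?A n w \<omega>'"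
        by (rule execution_relay_alg_cong)
      then show "\<forall>\<sigma> C. execution ?A n w \<omega>' \<sigma> C \<longrightarrow>
             succeeds ?A n w C \<and> message_complexity_le C (12 * real n ^ (d + 1))"
        using Q by simp
    qed
    moreover have "?G \<subseteq> ?E"
    proof (clarify, intro conjI)
      fix \<omega> l \<sigma> C
      assume l: "l < n" "\<forall>j<n. j \<noteq> l \<longrightarrow> random_id L (\<omega> j) < random_id L (\<omega> l)"
        and le: "\<forall>j<n. random_id L (\<omega> j) \<le> 2 * n ^ d"
        and exec: "execution ?A n w \<omega> \<sigma> C"
      interpret pulse_ring n w "\<lambda>i. random_id L (\<omega> i)"
        using n by unfold_locales simp
      show "succeeds ?A n w C"
        by (rule execution_succeeds[OF _ exec l(1)]) (use l(2) in simp_all)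
      have "sent (C t) \<le> 2 * n * (2 * (2 * n ^ d) + 2)" for t
        by (rule execution_sent_le[OF _ exec]) (use le in simp_all)
      \<comment> \<open>The 12 comes from \<open>4 * n ^ d + 2 \<le> 6 * n ^ d\<close>, as
        \<open>1 \<le> n ^ d\<close>.\<close>
      also have "2 * n * (2 * (2 * n ^ d) + 2) \<le> 12 * n ^ (d + 1)"
        using n one_le_power[of n d] by simp
      finally show "message_complexity_le C (12 * real n ^ (d + 1))"
        unfolding message_complexity_le_def by (metis of_nat_le_iff of_nat_mult of_nat_numeral of_nat_power)
    qed
    ultimately have "measure ?M ?G \<le> measure ?M ?E"
      by (intro M.finite_measure_mono)
    then show ?thesis using prob[OF n] by linarith
  qed
  then have "elects_whp ?A c"
    unfolding elects_whp_def by (intro exI allI impI)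
  \<comment> \<open>Quiescence holds for arbitrary identifiers, unique maximum or not, hence for
    every tape.\<close>
  moreover have "reaches_quiescence C \<and> never_terminates ?A n C"
    if "1 \<le> n" "execution ?A n w \<omega> \<sigma> C" for n w \<omega> \<sigma> C
  proof -
    interpret pulse_ring n w "\<lambda>i. random_id L (\<omega> i)"
      using that(1) by unfold_locales simp
    show ?thesis
      using execution_reaches_quiescence[OF _ that(2)]
      by (simp add: reaches_quiescence_def never_terminates_def)
  qed
  then have "\<forall>n\<ge>1. \<forall>w. AE \<omega> in random_space n. \<forall>\<sigma> C. execution ?A n w \<omega> \<sigma> C \<longrightarrow>
              reaches_quiescence C \<and> never_terminates ?A n C"
    by (intro allI impI AE_I2)
  ultimately show ?thesis
    by (intro exI[of _ ?A] conjI randomized_algorithm_relay_alg measurable_random_id)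
qed

end
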